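(* Let $d>0$. For randomized strategies for searching on the line with turn cost $d$, the optimal coefficient of $\mathrm{OPT}$ is the same as without turn cost; that is, $q_t=q$, where $q_t$ and $q$ denote the optimal coefficients of $\mathrm{OPT}$ with and without turn cost, respectively.
   Context: Searching on the line: an immobile target is hidden on the real line at an unknown point at distance $\mathrm{OPT}>0$ from the origin. The searcher starts at the origin, moves with speed at most one, and notices the target only when she reaches its position. Without turn cost: the cost of a search trajectory for a given target is the time until the target is reached. A randomized strategy is a probability distribution over search trajectories. The number $q$ is the optimal competitive ratio, i.e. the infimum of all $c$ such that some randomized strategy has expected cost at most $c\cdot\mathrm{OPT}$ for every target. It is known that $q=1+a$, where $a$ is the solution of $\frac{a+1}{\ln a}=a$, so $q=4.591121\ldots$. With turn cost $d$: the searcher additionally pays $d$ for each change of direction. A deterministic strategy consists of a starting direction and a sequence $x_1,x_2,\ldots$ of positive reals with $x_{i+2}>x_i$; the searcher alternately goes out to distance $x_i$ from the origin on the two sides, beginning in the starting direction. The cost for a target at distance $t$ is $2\sum_{i=1}^{k-1}x_i+(k-1)d+t$, where $k$ is the least index such that the $i=k$ turning point is on the target's side of the origin and $x_k\ge t$ (and $+\infty$ if there is no such $k$). A randomized strategy is a probability distribution over deterministic strategies. The number $q_t$ is the infimum of all $c$ for which there exist a constant $B$ and a randomized strategy such that, for every target, the expected cost is at most $c\cdot\mathrm{OPT}+B$. *)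

theory Defs
  imports "HOL-Probability.Probability"
begin

text \<open>
  A target is a real number \<open>z \<noteq> 0\<close>; its distance \<open>\<bar>z\<bar>\<close> from the origin is OPT.
  Costs take values in \<^typ>\<open>ennreal\<close>, with \<open>\<top>\<close> if the target is never found, and
  expected costs are \<open>nn_integral\<close>s. The coercion \<^const>\<open>ennreal\<close> maps negative reals
  to 0; this is harmless in the bounds below, since every cost is at least \<open>\<bar>z\<bar> > 0\<close>.
\<close>

text \<open>
  Trajectories are functions of time \<open>t \<ge> 0\<close>. They are extensional so that they are points of
  the product space over \<open>{0..}\<close>, whose sigma-algebra is generated by the positions at all times.
  Infinitely many changes of direction in finite time are allowed.
\<close>

definition trajectories :: "(real \<Rightarrow> real) set" where
  "trajectories = {g \<in> extensional {0..}. g 0 = 0 \<and> 1-lipschitz_on {0..} g}"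

definition trajectory_space :: "(real \<Rightarrow> real) measure" where
  "trajectory_space = restrict_space (\<Pi>\<^sub>M t\<in>{0..}. borel) trajectories"

definition search_cost :: "(real \<Rightarrow> real) \<Rightarrow> real \<Rightarrow> ennreal" where
  "search_cost g z = (INF t\<in>{t. 0 \<le> t \<and> g t = z}. ennreal t)"

definition randomized_strategy :: "(real \<Rightarrow> real) measure \<Rightarrow> bool" where
  "randomized_strategy P \<longleftrightarrow> prob_space P \<and> sets P = sets trajectory_space"

definition opt_ratio :: ereal where
  "opt_ratio = Inf (ereal ` {c. \<exists>P. randomized_strategy P \<and>
     (\<forall>z. z \<noteq> 0 \<longrightarrow> (\<integral>\<^sup>+ g. search_cost g z \<partial>P) \<le> ennreal (c * \<bar>z\<bar>))})"

text \<open>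
  In a strategy \<open>(r, x)\<close> for the problem with turn cost, \<open>r\<close> says whether the searcher starts
  in the positive direction. Turning points are numbered from 0, so \<open>x 0\<close> is the distance of
  the first one, and finding the target on the way to turning point \<open>k\<close> takes \<open>k\<close> turns.
\<close>

definition turn_strategies :: "(bool \<times> (nat \<Rightarrow> real)) set" where
  "turn_strategies = {(r, x). (\<forall>i. 0 < x i) \<and> (\<forall>i. x i < x (i + 2))}"

definition turn_strategy_space :: "(bool \<times> (nat \<Rightarrow> real)) measure" where
  "turn_strategy_space =
     restrict_space (count_space UNIV \<Otimes>\<^sub>M (\<Pi>\<^sub>M i\<in>UNIV. borel)) turn_strategies"

definition positive_side :: "bool \<Rightarrow> nat \<Rightarrow> bool" where
  "positive_side r k \<longleftrightarrow> (if even k then r else \<not> r)"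

definition finds :: "bool \<times> (nat \<Rightarrow> real) \<Rightarrow> real \<Rightarrow> nat \<Rightarrow> bool" where
  "finds s z k \<longleftrightarrow> (positive_side (fst s) k \<longleftrightarrow> 0 < z) \<and> \<bar>z\<bar> \<le> snd s k"

definition turn_cost :: "real \<Rightarrow> bool \<times> (nat \<Rightarrow> real) \<Rightarrow> real \<Rightarrow> ennreal" where
  "turn_cost d s z =
     (if \<exists>k. finds s z k
      then let k = (LEAST k. finds s z k)
           in ennreal (2 * (\<Sum>i<k. snd s i) + real k * d + \<bar>z\<bar>)
      else \<top>)"

definition randomized_turn_strategy :: "(bool \<times> (nat \<Rightarrow> real)) measure \<Rightarrow> bool" where
  "randomized_turn_strategy P \<longleftrightarrow> prob_space P \<and> sets P = sets turn_strategy_space"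

definition opt_turn_ratio :: "real \<Rightarrow> ereal" where
  "opt_turn_ratio d = Inf (ereal ` {c. \<exists>B P. randomized_turn_strategy P \<and>
     (\<forall>z. z \<noteq> 0 \<longrightarrow> (\<integral>\<^sup>+ s. turn_cost d s z \<partial>P) \<le> ennreal (c * \<bar>z\<bar> + B))})"

end

theory Submission imports Defs begin

text \<open>
  Neither optimal ratio is computed; strategies are converted into each other, with a loss in the
  ratio that can be made arbitrarily small.

  From trajectories to turning points: keep only the grid points \<open>\<plusminus>b ^ n\<close>, \<open>n \<ge> 0\<close>, for \<open>b\<close> close
  to 1, and visit them in the order in which the trajectory first hits them. The resulting zigzag
  is never later than the trajectory by more than a constant, and since every turn is followed by
  a new grid point it makes only \<open>O (log OPT)\<close> turns before the target is found. Their cost is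
  absorbed into \<open>\<epsilon> OPT + B\<close>.

  From turning points to trajectories: the constant \<open>B\<close> has to be removed for targets close to the
  origin. Truncate the strategy so that it explores exactly \<open>[-D, D]\<close> and returns to the origin,
  and perform scaled copies of it by the factors \<open>2 ^ (p n + j)\<close>, \<open>n = \<dots>, -1, 0, 1, \<dots>\<close>,
  one after another. A target is overcharged only by the earlier copies and by \<open>B\<close> times the scale
  \<open>w\<close> at which it is found. For uniformly random \<open>j < p\<close> the expectation of \<open>w\<close> is at most
  \<open>2 ^ p / p\<close> times the least scale that reaches the target, while all earlier copies together
  cost only the fraction \<open>1 / (2 ^ p - 1)\<close> of the copy at scale \<open>w\<close>. Choose \<open>p\<close> large first, and
  then \<open>D\<close>.
\<close>

subsection \<open>Visiting grid points in the order of their hitting times\<close>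

lemma turn_cost_le:
  assumes "finds s z k" "\<And>i. 0 < snd s i" "0 \<le> d"
  shows "turn_cost d s z \<le> ennreal (2 * (\<Sum>i<k. snd s i) + real k * d + \<bar>z\<bar>)"
proof -
  let ?l = "LEAST k. finds s z k"
  have "?l \<le> k" using assms(1) by (rule Least_le)
  then have "(\<Sum>i<?l. snd s i) \<le> (\<Sum>i<k. snd s i)" "real ?l * d \<le> real k * d"
    using assms(2,3) by (auto intro!: sum_mono2 mult_right_mono intro: less_imp_le)
  then show ?thesis
    using assms(1) by (auto simp: turn_cost_def Let_def intro!: ennreal_leI)
qed

lemma abs_le_turn_cost:
  assumes "\<And>i. 0 < snd s i" "0 \<le> d"
  shows "ennreal \<bar>z\<bar> \<le> turn_cost d s z"
  using assms by (auto simp: turn_cost_def Let_def less_imp_le intro!: ennreal_leI sum_nonneg add_nonneg_nonneg)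

text \<open>
  \<open>h r n\<close> is the time at which the grid point \<open>b ^ n\<close> on the positive (\<open>r\<close>) or negative (\<open>\<not> r\<close>)
  side is hit. The excursion before turn \<open>k\<close> ends at the grid point with number \<open>turn_index h k\<close>,
  so it goes on as long as its next grid point is hit before the first unvisited grid point on the
  other side.
\<close>

primrec turn_index :: "(bool \<Rightarrow> nat \<Rightarrow> real) \<Rightarrow> nat \<Rightarrow> nat" where
  "turn_index h 0 = 0"
| "turn_index h (Suc k) = (LEAST n. h (even k) (Suc (turn_index h k)) < h (odd k) (Suc n))"

text \<open>
  The points \<open>\<plusminus>1\<close> count as hit at time 0. This makes the zigzag start properly without
  a case distinction and costs only an additive constant.
\<close>

locale grid_hits =
  fixes b :: real and h :: "bool \<Rightarrow> nat \<Rightarrow> real"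
  assumes b: "1 < b"
    and h_0: "h r 0 = 0"
    and h_mono: "strict_mono (h r)"
    and h_ge: "1 \<le> n \<Longrightarrow> b ^ n \<le> h r n"
    and h_cross: "1 \<le> n \<Longrightarrow> 1 \<le> m \<Longrightarrow> h r n \<le> h (\<not> r) m \<Longrightarrow> h r n + b ^ n + b ^ m \<le> h (\<not> r) m"
begin

abbreviation M where "M \<equiv> turn_index h"

text \<open>The \<open>LEAST\<close> in \<open>turn_index\<close> ranges over a nonempty set,
  because \<open>h_ge\<close> makes the hitting times on the other side unbounded.\<close>

lemma turn_index_greater: "h (even k) (Suc (M k)) < h (odd k) (Suc (M (Suc k)))"
proof -
  obtain n where n: "h (even k) (Suc (M k)) < b ^ n"
    using real_arch_pow[OF b] by blast
  have "b ^ n \<le> b ^ Suc n" using b by (intro power_increasing) auto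
  also have "\<dots> \<le> h (odd k) (Suc n)" by (rule h_ge) simp
  finally have "\<exists>n. h (even k) (Suc (M k)) < h (odd k) (Suc n)" using n by (intro exI[of _ n]) linarith
  then show ?thesis unfolding turn_index.simps(2) by (rule LeastI_ex)
qed

lemma h_nonneg: "0 \<le> h r n"
  using strict_mono_less_eq[OF h_mono, of r 0 n] by (simp add: h_0)

text \<open>Minimality of the \<open>LEAST\<close>. At index 0 there is no smaller candidate, and
  \<open>h_0\<close> takes over.\<close>

lemma turn_index_le: "h (odd k) (M (Suc k)) \<le> h (even k) (Suc (M k))"
proof (cases "M (Suc k)")
  case 0
  then show ?thesis by (simp add: h_0 h_nonneg)
next
  case (Suc n)
  have "n < (LEAST n. h (even k) (Suc (M k)) < h (odd k) (Suc n))" using Suc by simp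
  from not_less_Least[OF this] show ?thesis using Suc by simp
qed

text \<open>Chaining two turns compares hits on the same side, where \<open>h\<close> is strictly
  increasing. This makes the zigzag a legal turn strategy.\<close>

lemma turn_index_mono: "M k < M (Suc (Suc k))"
proof -
  have "h (even k) (Suc (M k)) < h (even k) (Suc (M (Suc (Suc k))))"
    using turn_index_greater[of k] turn_index_greater[of "Suc k"] by simp
  then show ?thesis using strict_mono_less[OF h_mono] by simp
qed

text \<open>Bounds the number of turns linearly in the grid index, hence logarithmically in the
  distance.\<close>

lemma turn_index_ge: "k div 2 \<le> M k"
proof (induction k rule: less_induct)
  case (less k)
  show ?case
  proof (cases "k < 2")
    case False
    then obtain j where j: "k = Suc (Suc j)" by (metis add_2_eq_Suc le_iff_add not_less)
    then show ?thesis using less[of j] turn_index_mono[of j] by simp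
  qed auto
qed

lemma turn_hit_le: "h (even k) (M k) \<le> h (odd k) n" if "k = Suc j" "M j < n"
proof -
  have "h (even k) (M k) \<le> h (odd k) (Suc (M j))" using that turn_index_le[of j] by simp
  also have "\<dots> \<le> h (odd k) n" using that strict_mono_less_eq[OF h_mono] by simp
  finally show ?thesis .
qed

text \<open>From turning point \<open>k\<close> to point \<open>n\<close> on the other side the
  zigzag travels \<open>b ^ M k + b ^ n\<close>, and by \<open>h_cross\<close> the hitting times
  differ by at least as much, so the delay does not grow.\<close>

lemma sum_turns_step:
  assumes "k = Suc j" "M j < n" "2 * (\<Sum>i<k. b ^ M i) + b ^ M k \<le> h (even k) (M k) + 4"
  shows "2 * (\<Sum>i<Suc k. b ^ M i) + b ^ n \<le> h (odd k) n + 4"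
proof (cases "M k = 0")
  \<comment> \<open>\<open>h r 0 = 0\<close> is no genuine hitting time, so \<open>h_cross\<close>
    does not cover this case. It occurs only at \<open>k = 1\<close>, when both excursions have
    length 1; their total length 4 is the additive constant.\<close>
  case True
  then have "k = 1" using turn_index_ge[of k] assms(1) by auto
  then have "(\<Sum>i<Suc k. b ^ M i) = 2" using True by simp
  then show ?thesis using h_ge[of n "odd k"] assms(2) by simp
next
  case False
  then have "h (even k) (M k) + b ^ M k + b ^ n \<le> h (odd k) n"
    using h_cross[of "M k" n "even k"] turn_hit_le[OF assms(1,2)] assms(2) by auto
  then show ?thesis using assms(3) by simp
qed

lemma sum_turns: "2 * (\<Sum>i<Suc k. b ^ M i) + b ^ M (Suc k) \<le> h (odd k) (M (Suc k)) + 4"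
proof (induction k)
  case 0
  show ?case using h_ge[of "M 1" False] h_nonneg[of False "M 1"] by (cases "M 1 = 0") (auto simp del: turn_index.simps(2))
next
  case (Suc k)
  have "2 * (\<Sum>i<Suc (Suc k). b ^ M i) + b ^ M (Suc (Suc k)) \<le> h (odd (Suc k)) (M (Suc (Suc k))) + 4"
    by (rule sum_turns_step[OF refl turn_index_mono]) (use Suc in simp)
  then show ?case .
qed

lemma sum_turns_hit:
  assumes "M j < n"
  shows "2 * (\<Sum>i<Suc (Suc j). b ^ M i) + b ^ n \<le> h (even j) n + 4"
  using sum_turns_step[OF refl assms] sum_turns[of j] by (simp del: sum.lessThan_Suc turn_index.simps(2))

lemma turn_cost_grid:
  assumes z: "z \<noteq> 0" "\<bar>z\<bar> \<le> b ^ n" and n: "1 \<le> n" and d: "0 \<le> d"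
  shows "turn_cost d (True, \<lambda>k. b ^ M k) z \<le> ennreal (h (0 < z) n + (4 + (2 * real n + 1) * d))"
proof -
  define Q where "Q k \<longleftrightarrow> (even k \<longleftrightarrow> 0 < z) \<and> n \<le> M k" for k
  define k where "k = (LEAST k. Q k)"
  \<comment> \<open>By \<open>turn_index_ge\<close> this excursion, on the side of \<open>z\<close>,
    reaches index \<open>n\<close>.\<close>
  let ?k = "if 0 < z then 2 * n else 2 * n + 1"
  have "Q ?k" using turn_index_ge[of ?k] by (auto simp: Q_def simp del: turn_index.simps(2))
  then have k: "Q k" and k_le: "k \<le> ?k" unfolding k_def by (rule LeastI, rule Least_le)
  have "b ^ n \<le> b ^ M k" using k b by (auto simp: Q_def intro!: power_increasing)
  then have "finds (True, \<lambda>k. b ^ M k) z k"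
    using k z by (auto simp: finds_def positive_side_def Q_def)
  moreover have "2 * (\<Sum>i<k. b ^ M i) + b ^ n \<le> h (0 < z) n + 4"
  proof -
    consider "k = 0" | "k = 1" | j where "k = Suc (Suc j)"
      by (metis One_nat_def not0_implies_Suc)
    then show ?thesis
    proof cases
      case 3
      \<comment> \<open>Excursion \<open>j\<close> is the preceding one on the same side and ended
        short of index \<open>n\<close>, as \<open>sum_turns_hit\<close> requires.\<close>
      then have "\<not> Q j" unfolding k_def using not_less_Least[of j Q] by simp
      then have "M j < n" "even j \<longleftrightarrow> 0 < z" using k 3 by (auto simp: Q_def)
      then show ?thesis using sum_turns_hit[of j n] 3 by simp
    qed (use h_ge[OF n, of "0 < z"] in auto)
  qed
  moreover have "real k \<le> 2 * real n + 1"
    using k_le by (auto split: if_splits)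
  then have "real k * d \<le> (2 * real n + 1) * d"
    using d by (rule mult_right_mono)
  ultimately have "2 * (\<Sum>i<k. b ^ M i) + real k * d + \<bar>z\<bar> \<le> h (0 < z) n + (4 + (2 * real n + 1) * d)"
    using z(2) by linarith
  from ennreal_leI[OF this] show ?thesis
    using turn_cost_le[of "(True, \<lambda>k. b ^ M k)" z k d] \<open>finds (True, \<lambda>k. b ^ M k) z k\<close> b d
    by (force elim: order_trans[rotated])
qed

end

subsection \<open>Hitting times of trajectories\<close>

lemma trajectoryD:
  assumes "g \<in> trajectories"
  shows "g 0 = 0" "0 \<le> s \<Longrightarrow> 0 \<le> t \<Longrightarrow> \<bar>g s - g t\<bar> \<le> \<bar>s - t\<bar>" "continuous_on {0..} g"
  using assms by (auto simp: trajectories_def lipschitz_on_def dist_real_def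
    intro!: lipschitz_on_continuous_on[of 1])

lemma search_cost_le: "0 \<le> t \<Longrightarrow> g t = z \<Longrightarrow> search_cost g z \<le> ennreal t"
  unfolding search_cost_def by (auto intro: INF_lower)

text \<open>By continuity the set of hitting times is closed, so a nonempty one contains its
  infimum.\<close>

lemma search_cost_attained:
  assumes g: "g \<in> trajectories" and fin: "search_cost g z < \<top>"
  obtains t where "0 \<le> t" "g t = z" "search_cost g z = ennreal t"
proof -
  let ?A = "{t. 0 \<le> t \<and> g t = z}"
  have "?A \<noteq> {}" using fin unfolding search_cost_def by (metis INF_empty less_irrefl)
  have "closed ({0..} \<inter> g -` {z})"
    by (intro continuous_closed_preimage trajectoryD(3)[OF g]) auto
  also have "{0..} \<inter> g -` {z} = ?A" by auto
  finally have "Inf ?A \<in> ?A"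
    using \<open>?A \<noteq> {}\<close> by (intro closed_contains_Inf) (auto intro!: bdd_belowI[of _ 0])
  moreover have "search_cost g z = ennreal (Inf ?A)"
  proof (rule antisym)
    show "ennreal (Inf ?A) \<le> search_cost g z"
      unfolding search_cost_def
      by (rule INF_greatest) (auto intro!: ennreal_leI cInf_lower bdd_belowI[of _ 0])
  qed (use calculation in \<open>auto intro: search_cost_le\<close>)
  ultimately show ?thesis using that by auto
qed

text \<open>Describes the event through positions at countably many times, for measurability. Coming
  arbitrarily close to \<open>z\<close> at rational times up to \<open>q\<close> is enough, by
  compactness of the time interval.\<close>

lemma search_cost_less_iff:
  assumes g: "g \<in> trajectories"
  shows "search_cost g z < a \<longleftrightarrow> (\<exists>q::rat. 0 \<le> q \<and> ennreal (of_rat q) < a \<and>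
    (\<forall>m::nat. \<exists>r::rat. 0 \<le> r \<and> r \<le> q \<and> \<bar>g (of_rat r) - z\<bar> < 1 / real (Suc m)))"
    (is "?L \<longleftrightarrow> ?R")
proof
  assume ?L
  then obtain t where t: "0 \<le> t" "g t = z" "ennreal t < a"
    by (auto simp: search_cost_def INF_less_iff)
  obtain y where y: "t < y" "ennreal y < a"
  proof -
    obtain e where e: "ennreal t < e" "e < a" using dense t(3) by blast
    then have "e < \<top>" by (auto simp: less_top[symmetric])
    then obtain y where "e = ennreal y" "0 \<le> y" by (cases e) auto
    then show ?thesis using e that[of y] t by (auto simp: ennreal_less_iff)
  qed
  obtain q where q: "t < of_rat q" "of_rat q < y" using of_rat_dense y by blast
  have "\<exists>r::rat. 0 \<le> r \<and> r \<le> q \<and> \<bar>g (of_rat r) - z\<bar> < 1 / real (Suc m)" for m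
  proof -
    obtain r where r: "t < of_rat r" "of_rat r < min (of_rat q) (t + 1 / real (Suc m))"
      using of_rat_dense[of t "min (of_rat q) (t + 1 / real (Suc m))"] q by auto
    then have "0 \<le> (of_rat r :: real)" using t by linarith
    then have "\<bar>g (of_rat r) - z\<bar> \<le> \<bar>of_rat r - t\<bar>"
      using trajectoryD(2)[OF g, of "of_rat r" t] t by simp
    moreover have "0 \<le> r" using \<open>0 \<le> (of_rat r :: real)\<close> by (simp only: zero_le_of_rat_iff)
    ultimately show ?thesis using r by (intro exI[of _ r]) (auto simp: of_rat_less)
  qed
  moreover have "ennreal (of_rat q) < a"
    using q(2) y(2) by (meson ennreal_leI le_less_trans less_imp_le)
  moreover have "0 \<le> (of_rat q :: real)" using t q by linarith
  then have "0 \<le> q" by (simp add: zero_le_of_rat_iff)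
  ultimately show ?R by blast
next
  assume ?R
  then obtain q :: rat where q: "0 \<le> q" "ennreal (of_rat q) < a"
    and r: "\<And>m::nat. \<exists>r::rat. 0 \<le> r \<and> r \<le> q \<and> \<bar>g (of_rat r) - z\<bar> < 1 / real (Suc m)"
    by blast
  have "\<exists>t\<in>{0..of_rat q}. \<forall>u\<in>{0..of_rat q}. \<bar>g t - z\<bar> \<le> \<bar>g u - z\<bar>"
    using q by (intro continuous_attains_inf continuous_intros
      continuous_on_subset[OF trajectoryD(3)[OF g]]) (auto simp: zero_le_of_rat_iff)
  then obtain t where t: "0 \<le> t" "t \<le> of_rat q"
    and min: "\<And>u. 0 \<le> u \<Longrightarrow> u \<le> of_rat q \<Longrightarrow> \<bar>g t - z\<bar> \<le> \<bar>g u - z\<bar>" by auto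
  have "\<not> 0 < \<bar>g t - z\<bar>"
  proof
    assume "0 < \<bar>g t - z\<bar>"
    then obtain m where m: "inverse (real (Suc m)) < \<bar>g t - z\<bar>" using reals_Archimedean by blast
    obtain r :: rat where "0 \<le> r" "r \<le> q" "\<bar>g (of_rat r) - z\<bar> < 1 / real (Suc m)" using r by blast
    then show False using min[of "of_rat r"] m
      by (auto simp: zero_le_of_rat_iff of_rat_less_eq inverse_eq_divide)
  qed
  then have "search_cost g z \<le> ennreal t" using t by (auto intro: search_cost_le)
  also have "\<dots> \<le> ennreal (of_rat q)" using t by (auto intro: ennreal_leI)
  finally show ?L using q by simp
qed

lemma space_trajectory_space: "space trajectory_space = trajectories"
  by (auto simp: trajectory_space_def space_restrict_space space_PiM trajectories_def PiE_def)

lemma measurable_position: "0 \<le> t \<Longrightarrow> (\<lambda>g. g t) \<in> borel_measurable trajectory_space"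
  unfolding trajectory_space_def
  by (intro measurable_restrict_space1 measurable_component_singleton) auto

lemma borel_measurable_search_cost: "(\<lambda>g. search_cost g z) \<in> borel_measurable trajectory_space"
proof (rule borel_measurableI_less)
  fix a
  have *: "Measurable.pred trajectory_space (\<lambda>g. 0 \<le> r \<and> r \<le> q \<and> \<bar>g (of_rat r) - z\<bar> < 1 / real (Suc m))"
    for r q :: rat and m
  proof (cases "0 \<le> r")
    case True
    then have [measurable]: "(\<lambda>g. g (of_rat r)) \<in> borel_measurable trajectory_space"
      by (intro measurable_position) (simp add: zero_le_of_rat_iff)
    show ?thesis by measurable
  qed auto
  have "{g \<in> space trajectory_space. search_cost g z < a} = {g \<in> space trajectory_space.
     \<exists>q::rat. 0 \<le> q \<and> ennreal (of_rat q) < a \<and>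
    (\<forall>m::nat. \<exists>r::rat. 0 \<le> r \<and> r \<le> q \<and> \<bar>g (of_rat r) - z\<bar> < 1 / real (Suc m))}"
    by (auto simp: space_trajectory_space search_cost_less_iff)
  also have "\<dots> \<in> sets trajectory_space"
    by (intro predE pred_intros_countable(1,2) pred_intros_logic(3) pred_intros_logic(5) *) auto
  finally show "{g \<in> space trajectory_space. search_cost g z < a} \<in> sets trajectory_space" .
qed

text \<open>\<open>enn2real\<close> turns an infinite cost into 0, so the values are meaningful only
  when all grid points are reached.\<close>

definition hit_time :: "real \<Rightarrow> (real \<Rightarrow> real) \<Rightarrow> bool \<Rightarrow> nat \<Rightarrow> real" where
  "hit_time b g r n =
     (if n = 0 then 0 else enn2real (search_cost g ((if r then 1 else -1) * b ^ n)))"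

lemma grid_hits_hit_time:
  assumes g: "g \<in> trajectories" and b: "1 < b"
    and fin: "\<And>r n. search_cost g ((if r then 1 else -1) * b ^ n) < \<top>"
  shows "grid_hits b (hit_time b g)"
proof
  let ?p = "\<lambda>r n. (if r then 1 else -1) * b ^ n"
  have hit: "0 \<le> hit_time b g r n \<and> g (hit_time b g r n) = ?p r n" if "n \<noteq> 0" for r n
    using search_cost_attained[OF g fin] that by (smt (verit) enn2real_ennreal hit_time_def)
  have first: "hit_time b g r n \<le> t" if "n \<noteq> 0" "0 \<le> t" "g t = ?p r n" for r n t
    using search_cost_le[of t g] that by (auto simp: hit_time_def enn2real_leI)
  have pos: "0 < b ^ n" for n using b by simp
  show ge: "b ^ n \<le> hit_time b g r n" if "1 \<le> n" for r n
    using hit[of n r] trajectoryD(1)[OF g] trajectoryD(2)[OF g, of "hit_time b g r n" 0] that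
    by (auto split: if_splits)
  show "strict_mono (hit_time b g r)" for r
  proof (rule strict_monoI_Suc)
    fix n
    show "hit_time b g r n < hit_time b g r (Suc n)"
    proof (cases "n = 0")
      case True
      then show ?thesis using ge[of "Suc n" r] pos[of "Suc n"] by (simp add: hit_time_def)
    next
      case False
      let ?t = "hit_time b g r (Suc n)"
      have t: "0 \<le> ?t" "g ?t = ?p r (Suc n)" using hit[of "Suc n" r] by auto
      have less: "b ^ n < b ^ Suc n" using b by (intro power_strict_increasing) auto
      have cont: "continuous_on {0..?t} g" by (rule continuous_on_subset[OF trajectoryD(3)[OF g]]) auto
      \<comment> \<open>Starting from 0, the trajectory passes the grid point \<open>n\<close>
        before the farther one on the same side.\<close>
      have "\<exists>u\<ge>0. u \<le> ?t \<and> g u = ?p r n"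
      proof (cases r)
        case True
        then show ?thesis using t less pos[of n] trajectoryD(1)[OF g] cont
          by (intro IVT') auto
      next
        case False
        then show ?thesis using t less pos[of n] trajectoryD(1)[OF g] cont
          by (intro IVT2') auto
      qed
      then obtain u where u: "0 \<le> u" "u \<le> ?t" "g u = ?p r n" by auto
      have "u \<noteq> ?t" using u t less by (cases r) auto
      then show ?thesis using first[OF False u(1,3)] u(2) by simp
    qed
  qed
  \<comment> \<open>The two points lie on opposite sides, at distance \<open>b ^ n + b ^ m\<close>,
    and the speed is at most one.\<close>
  show "hit_time b g r n + b ^ n + b ^ m \<le> hit_time b g (\<not> r) m"
    if "1 \<le> n" "1 \<le> m" "hit_time b g r n \<le> hit_time b g (\<not> r) m" for n m r
    using hit[of n r] hit[of m "\<not> r"] trajectoryD(2)[OF g, of "hit_time b g r n" "hit_time b g (\<not> r) m"]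
      that pos[of n] pos[of m] by (cases r) auto
qed (use b in \<open>auto simp: hit_time_def\<close>)

section \<open>Random turn strategies from random trajectories\<close>

lemma measurable_turn_index:
  assumes h: "\<And>r n. (\<lambda>g. h g r n) \<in> borel_measurable N"
  shows "(\<lambda>g. turn_index (h g) k) \<in> measurable N (count_space UNIV)"
proof (induction k)
  case (Suc k)
  \<comment> \<open>The index depends on \<open>g\<close> itself, but takes only countably many
    values.\<close>
  have [measurable]: "(\<lambda>g. h g (even k) (Suc (turn_index (h g) k))) \<in> borel_measurable N"
    by (rule measurable_compose_countable[OF _ Suc]) (rule h)
  note h[measurable]
  show ?case by simp measurable
qed simp

text \<open>The left integral is a supremum over simple functions below \<open>f\<close>; each of
  them is measurable and transports along \<open>T\<close>. So \<open>f\<close> may be arbitrary, at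
  the price of an inequality.\<close>

lemma nn_integral_distr_le:
  assumes T: "T \<in> measurable M N"
  shows "(\<integral>\<^sup>+x. f x \<partial>distr M N T) \<le> (\<integral>\<^sup>+x. f (T x) \<partial>M)"
  unfolding nn_integral_def[of "distr M N T"]
proof (rule SUP_least)
  fix g assume "g \<in> {g. simple_function (distr M N T) g \<and> g \<le> f}"
  then have g: "simple_function (distr M N T) g" "g \<le> f" by auto
  then have [measurable]: "g \<in> borel_measurable N"
    using borel_measurable_simple_function[OF g(1)] by simp
  have "integral\<^sup>S (distr M N T) g = (\<integral>\<^sup>+x. g (T x) \<partial>M)"
    using T by (simp add: nn_integral_eq_simple_integral[symmetric] g nn_integral_distr)
  also have "\<dots> \<le> (\<integral>\<^sup>+x. f (T x) \<partial>M)"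
    using g(2) by (intro nn_integral_mono) (auto simp: le_fun_def)
  finally show "integral\<^sup>S (distr M N T) g \<le> (\<integral>\<^sup>+x. f (T x) \<partial>M)" .
qed


text \<open>Beyond \<open>m\<close> the increments of \<open>e * b ^ n\<close> exceed
  \<open>d\<close>. Used to absorb the cost of \<open>O(n)\<close> turns into
  \<open>e * b ^ n\<close>.\<close>

lemma linear_le_exponential:
  fixes b e d :: real
  assumes "1 < b" "0 < e" "0 \<le> d"
  shows "\<exists>B. \<forall>n::nat. n * d \<le> e * b ^ n + B"
proof -
  obtain m where "d / (e * (b - 1)) < b ^ m" using real_arch_pow[OF assms(1)] by blast
  then have m: "d \<le> e * b ^ m * (b - 1)" using assms by (simp add: field_simps)
  have "real n * d \<le> e * b ^ n + real m * d" for n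
  proof (cases "m \<le> n")
    case True
    have "real (n - m) * d \<le> real (n - m) * (e * b ^ m * (b - 1))" by (intro mult_left_mono m) simp
    also have "\<dots> = e * b ^ m * (real (n - m) * (b - 1))" by simp
    also have "\<dots> \<le> e * b ^ m * b ^ (n - m)"
      using Bernoulli_inequality[of "b - 1" "n - m"] assms by (intro mult_left_mono) auto
    also have "\<dots> = e * b ^ n" using True by (simp flip: power_add)
    finally show ?thesis using True by (simp add: of_nat_diff algebra_simps)
  next
    case False
    then have "real n * d \<le> real m * d" using assms by (intro mult_right_mono) auto
    then show ?thesis using assms by (simp add: add_increasing)
  qed
  then show ?thesis by blast
qed

lemma space_turn_strategy_space: "space turn_strategy_space = turn_strategies"
  by (auto simp: turn_strategy_space_def space_restrict_space space_pair_measure space_PiM)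

lemma le_search_cost: "g \<in> trajectories \<Longrightarrow> ennreal \<bar>z\<bar> \<le> search_cost g z"
  unfolding search_cost_def
  using trajectoryD(1)[of g] trajectoryD(2)[of g _ 0] by (auto intro!: INF_greatest ennreal_leI)

text \<open>Rounding the target up to the grid costs a factor \<open>b = 1 + e\<close>, and the
  turns cost another \<open>e * b ^ n\<close>; everything else is additive.\<close>

lemma turn_strategy_of_trajectories:
  fixes c c' d :: real
  assumes P: "randomized_strategy P"
    and bound: "\<And>z. z \<noteq> 0 \<Longrightarrow> (\<integral>\<^sup>+ g. search_cost g z \<partial>P) \<le> ennreal (c * \<bar>z\<bar>)"
    and c': "c < c'" and d: "0 \<le> d"
  shows "\<exists>B Q. randomized_turn_strategy Q \<and>
    (\<forall>z. z \<noteq> 0 \<longrightarrow> (\<integral>\<^sup>+ s. turn_cost d s z \<partial>Q) \<le> ennreal (c' * \<bar>z\<bar> + B))"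
proof -
  interpret prob_space P using P by (simp add: randomized_strategy_def)
  have sets_P[measurable_cong]: "sets P = sets trajectory_space"
    using P by (simp add: randomized_strategy_def)
  have space_P: "space P = trajectories"
    using sets_eq_imp_space_eq[OF sets_P] by (simp add: space_trajectory_space)
  note borel_measurable_search_cost[measurable]
  \<comment> \<open>A target at distance 1 costs at least 1, whence
    \<open>1 \<le> c\<close>.\<close>
  have "(\<integral>\<^sup>+ g. 1 \<partial>P) \<le> (\<integral>\<^sup>+ g. search_cost g 1 \<partial>P)"
    by (intro nn_integral_mono) (use le_search_cost[of _ 1] space_P in auto)
  also have "\<dots> \<le> ennreal c" using bound[of 1] by simp
  finally have c: "1 \<le> c" by (simp add: emeasure_space_1)
  \<comment> \<open>Chosen so that \<open>(c + e) * (1 + e) \<le> c + e * (c + 2) \<le> c'\<close>,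
    where \<open>e \<le> 1\<close> gives \<open>e * e \<le> e\<close>.\<close>
  define e where "e = min 1 ((c' - c) / (c + 2))"
  have e: "0 < e" "e \<le> 1" and "e \<le> (c' - c) / (c + 2)" using c c' by (auto simp: e_def)
  then have "e * (c + 2) \<le> c' - c" using c by (simp add: le_divide_eq)
  moreover have "e * e \<le> e" using e by (simp add: mult_le_cancel_left1)
  ultimately have e_c': "(c + e) * (1 + e) \<le> c'" by (simp add: algebra_simps)
  define b where "b = 1 + e"
  have b: "1 < b" using e by (simp add: b_def)
  obtain B where B: "\<And>n::nat. n * (2 * d) \<le> e * b ^ n + B"
    using linear_le_exponential[OF b e(1), of "2 * d"] d by auto
  define good where "good g \<longleftrightarrow> (\<forall>r n. search_cost g ((if r then 1 else -1) * b ^ n) < \<top>)" for g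
  \<comment> \<open>The values \<open>Suc k\<close> are an arbitrary legal strategy for the null set
    of trajectories that miss some grid point.\<close>
  define T where "T g = (True, if good g then (\<lambda>k. b ^ turn_index (hit_time b g) k) else (\<lambda>k. real (Suc k)))" for g
  have hit_meas[measurable]: "(\<lambda>g. hit_time b g r n) \<in> borel_measurable trajectory_space" for r n
    unfolding hit_time_def by (cases "n = 0") auto
  have [measurable]: "(\<lambda>g. turn_index (hit_time b g) k) \<in> measurable trajectory_space (count_space UNIV)" for k
    by (rule measurable_turn_index) (rule hit_meas)
  have good_meas[measurable]: "Measurable.pred trajectory_space good"
    unfolding good_def by measurable
  have "T \<in> measurable trajectory_space turn_strategy_space"
    unfolding turn_strategy_space_def
  proof (rule measurable_restrict_space2)
    have "turn_index (hit_time b g) k < turn_index (hit_time b g) (Suc (Suc k))"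
      if "g \<in> trajectories" "good g" for g k
      using grid_hits.turn_index_mono[OF grid_hits_hit_time, OF that(1) b] that(2) by (simp add: good_def)
    then show "T \<in> space trajectory_space \<rightarrow> turn_strategies"
      using b by (auto simp: space_trajectory_space T_def turn_strategies_def simp del: turn_index.simps)
    show "T \<in> measurable trajectory_space (count_space UNIV \<Otimes>\<^sub>M (\<Pi>\<^sub>M i\<in>UNIV. borel))"
      unfolding T_def
      by (intro measurable_Pair measurable_const measurable_If good_meas measurable_PiM_single')
        (auto simp: space_PiM)
  qed
  then have T[measurable]: "T \<in> measurable P turn_strategy_space" by simp
  define Q where "Q = distr P turn_strategy_space T"
  have "AE g in P. \<forall>r n. search_cost g ((if r then 1 else -1) * b ^ n) \<noteq> \<infinity>"
    unfolding AE_all_countable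
  proof (intro allI nn_integral_PInf_AE)
    fix r n
    have "(if r then 1 else - 1) * b ^ n \<noteq> 0" using b by simp
    from bound[OF this] show "(\<integral>\<^sup>+ g. search_cost g ((if r then 1 else -1) * b ^ n) \<partial>P) \<noteq> \<infinity>"
      by (auto simp: top_unique)
  qed auto
  then have good: "AE g in P. good g" by (simp add: good_def less_top[symmetric])
  have "(\<integral>\<^sup>+ s. turn_cost d s z \<partial>Q) \<le> ennreal (c' * \<bar>z\<bar> + (4 + d + B + c' * b))" if z: "z \<noteq> 0" for z
  proof -
    obtain n0 where "\<bar>z\<bar> < b ^ n0" using real_arch_pow[OF b] by blast
    also have "b ^ n0 \<le> b ^ Suc n0" using b by (intro power_increasing) auto
    finally have ex: "1 \<le> Suc n0 \<and> \<bar>z\<bar> \<le> b ^ Suc n0" by simp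
    \<comment> \<open>\<open>1 \<le> n\<close> avoids index 0, whose hitting time is fictitious. The
      price is the \<open>+ 1\<close> in \<open>b ^ l \<le> \<bar>z\<bar> + 1\<close>, which matters
      for targets close to the origin.\<close>
    define n where "n = (LEAST n. 1 \<le> n \<and> \<bar>z\<bar> \<le> b ^ n)"
    have n: "1 \<le> n" "\<bar>z\<bar> \<le> b ^ n" using LeastI[of "\<lambda>n. 1 \<le> n \<and> \<bar>z\<bar> \<le> b ^ n", OF ex] by (auto simp: n_def)
    obtain l where l: "n = Suc l" using n(1) by (cases n) auto
    have "b ^ l \<le> \<bar>z\<bar> + 1"
    proof (cases "l = 0")
      case False
      have "\<not> (1 \<le> l \<and> \<bar>z\<bar> \<le> b ^ l)" using l unfolding n_def by (intro not_less_Least) simp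
      then show ?thesis using False by simp
    qed simp
    then have bn: "b ^ n \<le> b * (\<bar>z\<bar> + 1)" using b l by simp
    let ?p = "(if 0 < z then 1 else -1) * b ^ n"
    have p: "?p \<noteq> 0" "\<bar>?p\<bar> = b ^ n" using b by auto
    have "(\<integral>\<^sup>+ s. turn_cost d s z \<partial>Q) \<le> (\<integral>\<^sup>+ g. turn_cost d (T g) z \<partial>P)"
      unfolding Q_def by (rule nn_integral_distr_le) simp
    also have "\<dots> \<le> (\<integral>\<^sup>+ g. search_cost g ?p + ennreal (4 + (2 * real n + 1) * d) \<partial>P)"
    proof (rule nn_integral_mono_AE, use good AE_space in eventually_elim)
      fix g assume g: "good g" "g \<in> space P"
      then have fin: "\<And>r n. search_cost g ((if r then 1 else -1) * b ^ n) < \<top>" by (simp add: good_def)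
      have "turn_cost d (T g) z \<le> ennreal (hit_time b g (0 < z) n + (4 + (2 * real n + 1) * d))"
        using grid_hits.turn_cost_grid[OF grid_hits_hit_time[OF _ b fin] z n(2,1) d] g
        by (simp add: T_def space_P)
      also have "\<dots> = ennreal (hit_time b g (0 < z) n) + ennreal (4 + (2 * real n + 1) * d)"
        using d n by (subst ennreal_plus) (auto simp: hit_time_def)
      also have "ennreal (hit_time b g (0 < z) n) = search_cost g ?p"
        using fin[of "0 < z" n] n by (simp add: hit_time_def)
      finally show "turn_cost d (T g) z \<le> search_cost g ?p + ennreal (4 + (2 * real n + 1) * d)" .
    qed
    also have "\<dots> = (\<integral>\<^sup>+ g. search_cost g ?p \<partial>P) + ennreal (4 + (2 * real n + 1) * d)"
      by (subst nn_integral_add) (auto simp: emeasure_space_1)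
    also have "\<dots> \<le> ennreal (c * b ^ n) + ennreal (4 + (2 * real n + 1) * d)"
      using bound[OF p(1)] p(2) by (intro add_right_mono) simp
    also have "\<dots> = ennreal (c * b ^ n + (4 + (2 * real n + 1) * d))"
      using c b d by (subst ennreal_plus) auto
    also have "\<dots> \<le> ennreal (c' * \<bar>z\<bar> + (4 + d + B + c' * b))"
    proof (rule ennreal_leI)
      have "c * b ^ n + (4 + (2 * real n + 1) * d) \<le> (c + e) * b ^ n + (4 + d + B)"
        using B[of n] by (simp add: algebra_simps)
      also have "(c + e) * b ^ n \<le> (c + e) * (b * (\<bar>z\<bar> + 1))"
        using c e by (intro mult_left_mono bn) auto
      also have "\<dots> = ((c + e) * (1 + e)) * (\<bar>z\<bar> + 1)" by (simp add: b_def)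
      also have "\<dots> \<le> c' * (\<bar>z\<bar> + 1)" by (intro mult_right_mono e_c') auto
      also have "\<dots> \<le> c' * \<bar>z\<bar> + c' * b" using b c c' by (simp add: distrib_left)
      finally show "c * b ^ n + (4 + (2 * real n + 1) * d) \<le> c' * \<bar>z\<bar> + (4 + d + B + c' * b)" by simp
    qed
    finally show ?thesis .
  qed
  moreover have "randomized_turn_strategy Q"
    unfolding randomized_turn_strategy_def Q_def by (auto intro!: prob_space_distr)
  ultimately show ?thesis by blast
qed

subsection \<open>Trajectories made of disjoint excursions\<close>

text \<open>A sum of tents of slope one: excursion \<open>m\<close> peaks at time \<open>a m\<close>
  at distance \<open>\<rho> m\<close>, and takes time \<open>\<rho> m\<close> each way. As a series
  it is easily measurable in its parameters.\<close>

definition zigzag :: "(nat \<Rightarrow> real) \<Rightarrow> (nat \<Rightarrow> real) \<Rightarrow> (nat \<Rightarrow> real) \<Rightarrow> real \<Rightarrow> real" where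
  "zigzag \<sigma> a \<rho> u = (\<Sum>m. \<sigma> m * max 0 (\<rho> m - \<bar>u - a m\<bar>))"

locale disjoint_excursions =
  fixes \<sigma> a \<rho> :: "nat \<Rightarrow> real"
  assumes disjoint: "m \<noteq> n \<Longrightarrow> \<rho> m + \<rho> n \<le> \<bar>a m - a n\<bar>"
    and sign: "\<bar>\<sigma> m\<bar> = 1"
begin

lemma zigzag_eq:
  assumes "\<bar>u - a m\<bar> \<le> \<rho> m"
  shows "zigzag \<sigma> a \<rho> u = \<sigma> m * (\<rho> m - \<bar>u - a m\<bar>)"
proof -
  have "\<sigma> n * max 0 (\<rho> n - \<bar>u - a n\<bar>) = 0" if "n \<noteq> m" for n
    using disjoint[OF that] assms by simp
  then have "zigzag \<sigma> a \<rho> u = (\<Sum>n\<in>{m}. \<sigma> n * max 0 (\<rho> n - \<bar>u - a n\<bar>))"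
    unfolding zigzag_def by (intro suminf_finite) auto
  then show ?thesis using assms by simp
qed

lemma zigzag_eq_0: "(\<And>m. \<rho> m \<le> \<bar>u - a m\<bar>) \<Longrightarrow> zigzag \<sigma> a \<rho> u = 0"
  by (simp add: zigzag_def max_absorb1)

lemma abs_zigzag_eq: "\<bar>u - a m\<bar> \<le> \<rho> m \<Longrightarrow> \<bar>zigzag \<sigma> a \<rho> u\<bar> = \<rho> m - \<bar>u - a m\<bar>"
  by (simp add: zigzag_eq abs_mult sign)

text \<open>A zero of the zigzag lies outside the interior of every tent, and a tent of slope one is
  bounded by the distance in time to its complement.\<close>

lemma abs_zigzag_le:
  assumes "zigzag \<sigma> a \<rho> v = 0"
  shows "\<bar>zigzag \<sigma> a \<rho> u\<bar> \<le> \<bar>u - v\<bar>"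
proof (cases "\<exists>m. \<bar>u - a m\<bar> < \<rho> m")
  case True
  then obtain m where m: "\<bar>u - a m\<bar> < \<rho> m" by blast
  have "\<rho> m \<le> \<bar>v - a m\<bar>"
    using abs_zigzag_eq[of v m] assms by fastforce
  then show ?thesis using abs_zigzag_eq[of u m] m by linarith
next
  case False
  then have "zigzag \<sigma> a \<rho> u = 0" by (intro zigzag_eq_0) (simp add: not_less)
  then show ?thesis by simp
qed

text \<open>Speed at most one. For times in two different tents, disjointness leaves enough time to
  return to 0 in between.\<close>

lemma abs_zigzag_diff_le: "\<bar>zigzag \<sigma> a \<rho> u - zigzag \<sigma> a \<rho> v\<bar> \<le> \<bar>u - v\<bar>"
proof (cases "zigzag \<sigma> a \<rho> u = 0 \<or> zigzag \<sigma> a \<rho> v = 0")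
  case True
  then show ?thesis using abs_zigzag_le[of u v] abs_zigzag_le[of v u] by auto
next
  case False
  then obtain m n where m: "\<bar>u - a m\<bar> < \<rho> m" and n: "\<bar>v - a n\<bar> < \<rho> n"
    using zigzag_eq_0[of u] zigzag_eq_0[of v] by (metis not_le)
  show ?thesis
  proof (cases "m = n")
    case True
    then have "\<bar>zigzag \<sigma> a \<rho> u - zigzag \<sigma> a \<rho> v\<bar> = \<bar>\<sigma> m * (\<bar>v - a m\<bar> - \<bar>u - a m\<bar>)\<bar>"
      using m n by (simp add: zigzag_eq[of u m] zigzag_eq[of v m] algebra_simps)
    also have "\<dots> = \<bar>\<bar>v - a m\<bar> - \<bar>u - a m\<bar>\<bar>" by (simp add: abs_mult sign)
    finally show ?thesis by linarith
  next
    case False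
    have "\<bar>zigzag \<sigma> a \<rho> u - zigzag \<sigma> a \<rho> v\<bar> \<le> \<bar>zigzag \<sigma> a \<rho> u\<bar> + \<bar>zigzag \<sigma> a \<rho> v\<bar>"
      by (rule abs_triangle_ineq4)
    also have "\<dots> = \<rho> m + \<rho> n - \<bar>u - a m\<bar> - \<bar>v - a n\<bar>"
      using abs_zigzag_eq[of u m] abs_zigzag_eq[of v n] m n by simp
    also have "\<dots> \<le> \<bar>a m - a n\<bar> - \<bar>u - a m\<bar> - \<bar>v - a n\<bar>"
      by (intro diff_right_mono disjoint False)
    also have "\<dots> \<le> \<bar>u - v\<bar>" by linarith
    finally show ?thesis .
  qed
qed

end

subsection \<open>Self-similar trajectories\<close>

definition explored :: "real \<Rightarrow> bool \<times> (nat \<Rightarrow> real) \<Rightarrow> nat \<Rightarrow> bool" where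
  "explored D s i \<longleftrightarrow> (\<exists>k<i. finds s D k) \<and> (\<exists>k<i. finds s (- D) k)"

text \<open>Stopping once both \<open>D\<close> and \<open>- D\<close> are found leaves finitely
  many nonzero excursions, so that the loop has finite length.\<close>

definition excursion :: "real \<Rightarrow> bool \<times> (nat \<Rightarrow> real) \<Rightarrow> nat \<Rightarrow> real" where
  "excursion D s i = (if explored D s i then 0 else min (snd s i) D)"

definition loop_length :: "real \<Rightarrow> bool \<times> (nat \<Rightarrow> real) \<Rightarrow> real" where
  "loop_length D s = 2 * (\<Sum>i. excursion D s i)"

text \<open>
  The first summand is the duration of all earlier copies, a geometric series with ratio \<open>2 ^ p\<close>.
\<close>

definition excursion_start :: "nat \<Rightarrow> real \<Rightarrow> bool \<times> (nat \<Rightarrow> real) \<Rightarrow> nat \<Rightarrow> real" where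
  "excursion_start p D s i = loop_length D s / (2 ^ p - 1) + 2 * (\<Sum>l<i. excursion D s l)"

text \<open>For fixed \<open>j\<close> the exponents form the residue class of \<open>j\<close>
  modulo \<open>p\<close>; over all \<open>j < p\<close> every power of 2 occurs exactly
  once.\<close>

definition loop_scale :: "nat \<Rightarrow> nat \<Rightarrow> int \<Rightarrow> real" where
  "loop_scale p j n = 2 powi (int p * n + int j)"

text \<open>Excursions are indexed by pairs of an integer (the copy) and a natural number (the
  turn); \<open>zigzag\<close> needs them enumerated by naturals.\<close>

definition loop_of :: "nat \<Rightarrow> int" where "loop_of m = int_decode (fst (prod_decode m))"
definition turn_of :: "nat \<Rightarrow> nat" where "turn_of m = snd (prod_decode m)"

definition spiral_sign :: "bool \<times> (nat \<Rightarrow> real) \<Rightarrow> nat \<Rightarrow> real" where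
  "spiral_sign s m = (if positive_side (fst s) (turn_of m) then 1 else - 1)"

definition spiral_peak :: "nat \<Rightarrow> real \<Rightarrow> nat \<Rightarrow> bool \<times> (nat \<Rightarrow> real) \<Rightarrow> nat \<Rightarrow> real" where
  "spiral_peak p D j s m = loop_scale p j (loop_of m) *
     (excursion_start p D s (turn_of m) + excursion D s (turn_of m))"

definition spiral_radius :: "nat \<Rightarrow> real \<Rightarrow> nat \<Rightarrow> bool \<times> (nat \<Rightarrow> real) \<Rightarrow> nat \<Rightarrow> real" where
  "spiral_radius p D j s m = loop_scale p j (loop_of m) * excursion D s (turn_of m)"

definition spiral :: "nat \<Rightarrow> real \<Rightarrow> nat \<Rightarrow> bool \<times> (nat \<Rightarrow> real) \<Rightarrow> real \<Rightarrow> real" where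
  "spiral p D j s = restrict (zigzag (spiral_sign s) (spiral_peak p D j s) (spiral_radius p D j s)) {0..}"

lemma index_surj: obtains m where "loop_of m = n" "turn_of m = i"
  by (rule that[of "prod_encode (int_encode n, i)"]) (auto simp: loop_of_def turn_of_def)

lemma index_inj: "loop_of m = loop_of m' \<Longrightarrow> turn_of m = turn_of m' \<Longrightarrow> m = m'"
  by (metis loop_of_def turn_of_def int_decode_inverse prod_decode_inverse prod.collapse)

lemma loop_scale_pos: "0 < loop_scale p j n"
  by (simp add: loop_scale_def)

lemma loop_scale_less:
  assumes "n < n'"
  shows "2 ^ p * loop_scale p j n \<le> loop_scale p j n'"
proof -
  have "2 ^ p * loop_scale p j n = 2 powi (int p * (n + 1) + int j)"
    by (simp add: loop_scale_def power_int_add algebra_simps)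
  also have "\<dots> \<le> loop_scale p j n'"
    unfolding loop_scale_def using assms by (intro power_int_increasing add_right_mono mult_left_mono) auto
  finally show ?thesis .
qed

context
  fixes p :: nat and D :: real and s :: "bool \<times> (nat \<Rightarrow> real)"
  assumes p: "1 \<le> p" and D: "0 < D" and s: "s \<in> turn_strategies"
begin

lemma strategy_pos: "0 < snd s i"
  using s by (auto simp: turn_strategies_def)

lemma excursion_bounds: "0 \<le> excursion D s i" "excursion D s i \<le> snd s i" "excursion D s i \<le> D"
  using D strategy_pos[of i] by (auto simp: excursion_def)

text \<open>Truncation loses no target in \<open>[-D, D]\<close>: an excursion that finds the
  endpoint on the side of \<open>z\<close> also finds \<open>z\<close>, so exploration is not
  complete before \<open>z\<close> is found.\<close>

lemma excursion_before_find:
  assumes "z \<noteq> 0" "\<bar>z\<bar> \<le> D" "finds s z k" "\<And>l. l < k \<Longrightarrow> \<not> finds s z l"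
  shows "\<bar>z\<bar> \<le> excursion D s k"
proof -
  have "\<not> explored D s k"
    using assms D by (cases "0 < z") (force simp: explored_def finds_def)+
  then show ?thesis using assms by (auto simp: excursion_def finds_def)
qed

lemma two_power_gt_1: "(1::real) < 2 ^ p"
  using p by (intro one_less_power) auto

context
  assumes found: "\<exists>k. finds s D k" "\<exists>k. finds s (- D) k"
begin

lemma excursion_eventually_0: "\<exists>k. \<forall>i>k. excursion D s i = 0"
proof -
  obtain k l where "finds s D k" "finds s (- D) l" using found by blast
  then have "explored D s i" if "i > max k l" for i using that by (auto simp: explored_def)
  then show ?thesis by (intro exI[of _ "max k l"]) (auto simp: excursion_def)
qed

lemma summable_excursion: "summable (excursion D s)"
proof -
  obtain k where "\<forall>i>k. excursion D s i = 0" using excursion_eventually_0 by blast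
  then show ?thesis by (intro summable_finite[of "{..k}"]) auto
qed

lemma sum_excursion_le: "2 * (\<Sum>l<i. excursion D s l) \<le> loop_length D s"
  unfolding loop_length_def
  by (intro mult_left_mono sum_le_suminf summable_excursion) (auto simp: excursion_bounds)

lemma loop_length_nonneg: "0 \<le> loop_length D s"
  using sum_excursion_le[of 0] by simp

lemma excursion_start_nonneg: "0 \<le> excursion_start p D s i"
  using loop_length_nonneg two_power_gt_1
  by (auto simp: excursion_start_def excursion_bounds intro!: add_nonneg_nonneg sum_nonneg)

lemma excursion_start_mono: "i \<le> i' \<Longrightarrow> excursion_start p D s i \<le> excursion_start p D s i'"
  by (auto simp: excursion_start_def excursion_bounds intro!: sum_mono2)

text \<open>With \<open>L\<close> the loop length,
  \<open>L / (2 ^ p - 1) + L = 2 ^ p * (L / (2 ^ p - 1))\<close>: a copy ends exactly when the next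
  one, larger by the factor \<open>2 ^ p\<close>, starts.\<close>

lemma excursion_start_le: "excursion_start p D s i \<le> 2 ^ p * excursion_start p D s 0"
proof -
  have "excursion_start p D s i \<le> loop_length D s / (2 ^ p - 1) + loop_length D s"
    using sum_excursion_le by (simp add: excursion_start_def)
  also have "\<dots> = 2 ^ p * excursion_start p D s 0"
    using two_power_gt_1 by (simp add: excursion_start_def field_simps)
  finally show ?thesis .
qed

lemma spiral_peak_minus: "spiral_peak p D j s m - spiral_radius p D j s m =
    loop_scale p j (loop_of m) * excursion_start p D s (turn_of m)"
  by (simp add: spiral_peak_def spiral_radius_def algebra_simps)

lemma spiral_peak_plus: "spiral_peak p D j s m + spiral_radius p D j s m =
    loop_scale p j (loop_of m) * excursion_start p D s (Suc (turn_of m))"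
  by (simp add: spiral_peak_def spiral_radius_def excursion_start_def algebra_simps)

lemma spiral_order:
  assumes "loop_of m < loop_of m' \<or> loop_of m = loop_of m' \<and> turn_of m < turn_of m'"
  shows "spiral_peak p D j s m + spiral_radius p D j s m \<le> spiral_peak p D j s m' - spiral_radius p D j s m'"
  unfolding spiral_peak_minus spiral_peak_plus using assms
proof
  assume less: "loop_of m < loop_of m'"
  have "loop_scale p j (loop_of m) * excursion_start p D s (Suc (turn_of m)) \<le>
      loop_scale p j (loop_of m) * (2 ^ p * excursion_start p D s 0)"
    by (intro mult_left_mono excursion_start_le less_imp_le loop_scale_pos)
  also have "\<dots> = (2 ^ p * loop_scale p j (loop_of m)) * excursion_start p D s 0" by simp
  also have "\<dots> \<le> loop_scale p j (loop_of m') * excursion_start p D s (turn_of m')"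
    using loop_scale_pos[of p j] by (intro mult_mono loop_scale_less less excursion_start_mono excursion_start_nonneg)
      (auto intro: less_imp_le)
  finally show "loop_scale p j (loop_of m) * excursion_start p D s (Suc (turn_of m)) \<le>
      loop_scale p j (loop_of m') * excursion_start p D s (turn_of m')" .
next
  assume "loop_of m = loop_of m' \<and> turn_of m < turn_of m'"
  then show "loop_scale p j (loop_of m) * excursion_start p D s (Suc (turn_of m)) \<le>
      loop_scale p j (loop_of m') * excursion_start p D s (turn_of m')"
    using loop_scale_pos[of p j "loop_of m"] by (auto intro!: mult_left_mono excursion_start_mono)
qed

interpretation disjoint_excursions "spiral_sign s" "spiral_peak p D j s" "spiral_radius p D j s"
proof
  fix m n :: nat assume "m \<noteq> n"
  then have "loop_of m \<noteq> loop_of n \<or> turn_of m \<noteq> turn_of n" using index_inj by blast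
  then have "(loop_of m < loop_of n \<or> loop_of m = loop_of n \<and> turn_of m < turn_of n) \<or>
     (loop_of n < loop_of m \<or> loop_of n = loop_of m \<and> turn_of n < turn_of m)" by auto
  then show "spiral_radius p D j s m + spiral_radius p D j s n \<le> \<bar>spiral_peak p D j s m - spiral_peak p D j s n\<bar>"
    using spiral_order[of m n j] spiral_order[of n m j] by linarith
qed (simp add: spiral_sign_def)

text \<open>The small copies accumulate at time 0. The position there is 0 since every excursion
  starts at a nonnegative time.\<close>

lemma spiral_trajectory: "spiral p D j s \<in> trajectories"
proof -
  have "spiral_radius p D j s m \<le> \<bar>0 - spiral_peak p D j s m\<bar>" for m
    using spiral_peak_minus[of j m] mult_nonneg_nonneg[OF less_imp_le[OF loop_scale_pos] excursion_start_nonneg, of p j "loop_of m" "turn_of m"]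
    by linarith
  then have "zigzag (spiral_sign s) (spiral_peak p D j s) (spiral_radius p D j s) 0 = 0"
    by (rule zigzag_eq_0)
  then show ?thesis
    using abs_zigzag_diff_le
    by (auto simp: trajectories_def spiral_def lipschitz_on_def dist_real_def)
qed

text \<open>Copy \<open>n\<close> alone suffices to find \<open>z\<close>; the first summand pays
  for all earlier copies. If the original strategy misses the rescaled target, the bound is
  infinite.\<close>

lemma search_cost_spiral:
  assumes z: "z \<noteq> 0" "\<bar>z\<bar> \<le> D * loop_scale p j n" and d: "0 \<le> d"
  shows "search_cost (spiral p D j s) z \<le> ennreal (loop_scale p j n) *
    (ennreal (loop_length D s / (2 ^ p - 1)) + turn_cost d s (z / loop_scale p j n))"
proof -
  define w where "w = loop_scale p j n"
  have w: "0 < w" by (simp add: w_def loop_scale_pos)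
  define y where "y = z / w"
  have y: "y \<noteq> 0" "\<bar>y\<bar> \<le> D" "z = w * y" using z w by (auto simp: y_def w_def[symmetric] abs_divide field_simps)
  show ?thesis
  proof (cases "\<exists>k. finds s y k")
    case False
    then show ?thesis using w by (simp add: turn_cost_def y_def[symmetric] w_def[symmetric] ennreal_mult_top)
  next
    case True
    define k where "k = (LEAST k. finds s y k)"
    have k: "finds s y k" using True unfolding k_def by (rule LeastI_ex)
    have yk: "\<bar>y\<bar> \<le> excursion D s k"
      using not_less_Least[of _ "finds s y"] unfolding k_def[symmetric]
      by (intro excursion_before_find y(1,2) k)
    obtain m where m: "loop_of m = n" "turn_of m = k" by (rule index_surj)
    \<comment> \<open>The time at which excursion \<open>k\<close> of copy \<open>n\<close> passes
      \<open>z\<close> on its way out.\<close>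
    define u where "u = w * (excursion_start p D s k + \<bar>y\<bar>)"
    have peak: "spiral_peak p D j s m = w * excursion_start p D s k + spiral_radius p D j s m"
      using spiral_peak_minus[of j m] m by (simp add: w_def)
    have rad: "w * \<bar>y\<bar> \<le> spiral_radius p D j s m"
      using yk w by (simp add: spiral_radius_def m w_def)
    have "u - spiral_peak p D j s m = w * \<bar>y\<bar> - spiral_radius p D j s m"
      by (simp add: u_def peak algebra_simps)
    moreover have "0 \<le> w * \<bar>y\<bar>" using w by simp
    ultimately have "zigzag (spiral_sign s) (spiral_peak p D j s) (spiral_radius p D j s) u = spiral_sign s m * (w * \<bar>y\<bar>)"
      using rad by (subst zigzag_eq[of u j m]) auto
    also have "\<dots> = z" using k y by (auto simp: spiral_sign_def m finds_def)
    finally have "zigzag (spiral_sign s) (spiral_peak p D j s) (spiral_radius p D j s) u = z" .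
    moreover have u: "0 \<le> u" using w excursion_start_nonneg[of k] by (simp add: u_def)
    ultimately have "search_cost (spiral p D j s) z \<le> ennreal u"
      by (intro search_cost_le) (auto simp: spiral_def)
    also have "ennreal u \<le> ennreal (w * (loop_length D s / (2 ^ p - 1) + (2 * (\<Sum>i<k. snd s i) + real k * d + \<bar>y\<bar>)))"
    proof -
      have "(\<Sum>i<k. excursion D s i) \<le> (\<Sum>i<k. snd s i)" by (intro sum_mono excursion_bounds)
      then have "2 * (\<Sum>i<k. excursion D s i) \<le> 2 * (\<Sum>i<k. snd s i) + real k * d"
        using mult_nonneg_nonneg[OF of_nat_0_le_iff d, of k] by linarith
      then show ?thesis using w unfolding u_def excursion_start_def
        by (intro ennreal_leI mult_left_mono) auto
    qed
    also have "\<dots> = ennreal w * (ennreal (loop_length D s / (2 ^ p - 1)) + turn_cost d s y)"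
    proof -
      have "0 \<le> loop_length D s / (2 ^ p - 1)" using loop_length_nonneg two_power_gt_1 by simp
      moreover have "0 \<le> (\<Sum>i<k. snd s i)" by (intro sum_nonneg less_imp_le strategy_pos)
      ultimately show ?thesis using True d w
        by (simp add: turn_cost_def k_def[symmetric] ennreal_mult flip: ennreal_plus)
    qed
    finally show ?thesis by (simp add: w_def y_def)
  qed
qed

text \<open>The endpoint found last pays for all excursions but the final one, and for
  \<open>D\<close> once; the other endpoint pays for the second \<open>D\<close>. Thus the bounds at
  \<open>D\<close> and \<open>- D\<close> control the expected loop length.\<close>

lemma loop_length_le:
  assumes d: "0 \<le> d"
  shows "ennreal (loop_length D s) \<le> turn_cost d s D + turn_cost d s (- D)"
proof -
  \<comment> \<open>Here \<open>z\<close> is the endpoint that is found last.\<close>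
  have *: "ennreal (loop_length D s) \<le> turn_cost d s z + turn_cost d s (- z)"
    if z: "z = D \<or> z = - D" and kl: "(LEAST k. finds s (- z) k) \<le> (LEAST k. finds s z k)" for z
  proof -
    define k where "k = (LEAST k. finds s z k)"
    have ex: "\<exists>k. finds s z k" "\<exists>k. finds s (- z) k" using z found by auto
    have "finds s z k" "finds s (- z) (LEAST k. finds s (- z) k)"
      using LeastI_ex[OF ex(1)] LeastI_ex[OF ex(2)] by (auto simp: k_def)
    then have "(\<exists>l<i. finds s z l) \<and> (\<exists>l<i. finds s (- z) l)" if "k < i" for i
      using le_less_trans[OF kl, of i] that k_def by blast
    then have "explored D s i" if "k < i" for i
      using z that by (auto simp: explored_def)
    then have "loop_length D s = 2 * (\<Sum>i<Suc k. excursion D s i)"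
      unfolding loop_length_def by (subst suminf_finite[of "{..<Suc k}"]) (auto simp: excursion_def)
    also have "\<dots> \<le> 2 * (\<Sum>i<k. snd s i) + 2 * D"
      using sum_mono[of "{..<k}" "excursion D s" "snd s"] excursion_bounds(2) excursion_bounds(3)[of k] by simp
    also have "\<dots> \<le> (2 * (\<Sum>i<k. snd s i) + real k * d + D) + D" using d by simp
    finally have "ennreal (loop_length D s) \<le> ennreal ((2 * (\<Sum>i<k. snd s i) + real k * d + D) + D)"
      by (rule ennreal_leI)
    also have "\<dots> = turn_cost d s z + ennreal \<bar>- z\<bar>"
    proof -
      have "\<bar>z\<bar> = D" "\<bar>- z\<bar> = D" using z D by auto
      moreover have "0 \<le> 2 * (\<Sum>i<k. snd s i) + real k * d + D"
        using d D strategy_pos by (intro add_nonneg_nonneg mult_nonneg_nonneg sum_nonneg) (auto intro: less_imp_le)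
      ultimately show ?thesis
        using ex(1) D by (subst ennreal_plus) (simp_all add: turn_cost_def k_def[symmetric])
    qed
    also have "\<dots> \<le> turn_cost d s z + turn_cost d s (- z)"
      by (intro add_left_mono abs_le_turn_cost strategy_pos d)
    finally show ?thesis .
  qed
  show ?thesis
  proof (cases "(LEAST k. finds s (- D) k) \<le> (LEAST k. finds s D k)")
    case True
    then show ?thesis using *[of D] by simp
  next
    case False
    then show ?thesis using *[of "- D"] by (simp add: add.commute)
  qed
qed

end

end

section \<open>Measurability and random scaling: random trajectories from random turn
  strategies\<close>

lemma measurable_turn_strategy:
  "(\<lambda>s. snd s i) \<in> borel_measurable turn_strategy_space"
  "fst \<in> measurable turn_strategy_space (count_space UNIV)"
  unfolding turn_strategy_space_def
  by (intro measurable_restrict_space1, measurable)+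

lemma measurable_finds: "Measurable.pred turn_strategy_space (\<lambda>s. finds s z k)"
proof -
  note measurable_turn_strategy[measurable]
  have [measurable]: "Measurable.pred turn_strategy_space (\<lambda>s. positive_side (fst s) k)"
    by (rule measurable_compose[OF measurable_turn_strategy(2)]) simp
  show ?thesis unfolding finds_def by measurable
qed

lemma measurable_turn_cost: "(\<lambda>s. turn_cost d s z) \<in> borel_measurable turn_strategy_space"
proof -
  note measurable_turn_strategy[measurable] measurable_finds[measurable]
  have [measurable]: "(\<lambda>s. LEAST k. finds s z k) \<in> measurable turn_strategy_space (count_space UNIV)"
    by measurable
  have [measurable]: "(\<lambda>s. ennreal (2 * (\<Sum>i<(LEAST k. finds s z k). snd s i) + real (LEAST k. finds s z k) * d + \<bar>z\<bar>))
      \<in> borel_measurable turn_strategy_space"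
    by (rule measurable_compose_countable[where g = "\<lambda>s. LEAST k. finds s z k"]) measurable
  show ?thesis unfolding turn_cost_def Let_def by measurable
qed

lemma measurable_spiral:
  "(\<lambda>x. spiral p D (fst x) (snd x)) \<in> measurable (count_space UNIV \<Otimes>\<^sub>M turn_strategy_space) (\<Pi>\<^sub>M t\<in>{0..}. borel)"
proof -
  note measurable_turn_strategy[measurable] measurable_finds[measurable]
  have [measurable]: "(\<lambda>s. excursion D s i) \<in> borel_measurable turn_strategy_space" for i
    unfolding excursion_def explored_def by measurable
  have [measurable]: "(\<lambda>s. loop_length D s) \<in> borel_measurable turn_strategy_space"
    unfolding loop_length_def by measurable
  have [measurable]: "(\<lambda>s. excursion_start p D s i) \<in> borel_measurable turn_strategy_space" for i
    unfolding excursion_start_def by measurable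
  have [measurable]: "(\<lambda>s. spiral_sign s m) \<in> borel_measurable turn_strategy_space" for m
    unfolding spiral_sign_def by (rule measurable_compose[OF measurable_turn_strategy(2)]) simp
  have [measurable]: "(\<lambda>j. loop_scale p j n) \<in> borel_measurable (count_space UNIV)" for n
    by simp
  show ?thesis
    unfolding spiral_def zigzag_def spiral_peak_def spiral_radius_def
    by (intro measurable_restrict) measurable
qed


text \<open>The least exponent that is at least \<open>e\<close> and congruent to \<open>j\<close>
  is \<open>e + i j\<close>. As \<open>j\<close> runs through all residues, so does
  \<open>i j\<close>, and the scales add up to the geometric sum
  \<open>2 powi e * (2 ^ p - 1)\<close>.\<close>

lemma sum_scales:
  assumes p: "1 \<le> p" and D: "0 < D" and z: "z \<noteq> 0"
  obtains n where "\<And>j. \<bar>z\<bar> \<le> D * loop_scale p j (n j)"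
    "(\<Sum>j<p. loop_scale p j (n j)) \<le> 2 * \<bar>z\<bar> / D * (2 ^ p - 1)"
proof -
  define e where "e = \<lceil>log 2 (\<bar>z\<bar> / D)\<rceil>"
  define i where "i j = nat ((int j - e) mod int p)" for j
  define n where "n j = (e + int (i j) - int j) div int p" for j
  have pos: "0 < \<bar>z\<bar> / D" using z D by simp
  have "\<bar>z\<bar> / D = 2 powr log 2 (\<bar>z\<bar> / D)" using pos by simp
  also have "\<dots> \<le> 2 powr e" by (intro powr_mono) (auto simp: e_def)
  finally have z_le: "\<bar>z\<bar> \<le> D * 2 powi e" using D by (simp add: powr_real_of_int' field_simps)
  have "2 powr e \<le> 2 powr (log 2 (\<bar>z\<bar> / D) + 1)"
    by (intro powr_mono) (auto simp: e_def ceiling_correct less_imp_le)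
  also have "\<dots> = 2 * \<bar>z\<bar> / D" using pos by (simp add: powr_add)
  finally have z_ge: "2 powi e \<le> 2 * \<bar>z\<bar> / D" by (simp add: powr_real_of_int')
  have loop_scale_n: "loop_scale p j (n j) = 2 powi e * 2 ^ i j" for j
  proof -
    have ij: "int (i j) = (int j - e) mod int p" using p by (simp add: i_def)
    have "int p dvd e + int (i j) - int j"
      unfolding ij by (metis (no_types) add_diff_eq diff_diff_eq2 dvd_minus_mod dvd_minus_iff minus_diff_eq add.commute)
    then have "int p * n j + int j = e + int (i j)" by (simp add: n_def)
    then show ?thesis by (simp add: loop_scale_def power_int_add)
  qed
  have "\<bar>z\<bar> \<le> D * loop_scale p j (n j)" for j
  proof -
    have "D * 2 powi e * 1 \<le> D * 2 powi e * 2 ^ i j" using D by (intro mult_left_mono) auto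
    then show ?thesis using z_le by (simp add: loop_scale_n mult.assoc)
  qed
  moreover have "(\<Sum>j<p. loop_scale p j (n j)) \<le> 2 * \<bar>z\<bar> / D * (2 ^ p - 1)"
  proof -
    have "inj_on i {..<p}"
    proof (rule inj_onI)
      fix j k assume jk: "j \<in> {..<p}" "k \<in> {..<p}" "i j = i k"
      then have "(int j - e) mod int p = (int k - e) mod int p"
        using p by (simp add: i_def eq_nat_nat_iff)
      then have "(int j - e + e) mod int p = (int k - e + e) mod int p" by (rule mod_add_cong) simp
      then show "j = k" using jk by (simp flip: of_nat_mod)
    qed
    moreover have "i ` {..<p} \<subseteq> {..<p}" using p by (auto simp: i_def nat_less_iff)
    ultimately have "bij_betw i {..<p} {..<p}" by (simp add: bij_betw_def endo_inj_surj)
    then have "(\<Sum>j<p. 2 ^ i j) = (\<Sum>k<p. (2::real) ^ k)" by (rule sum.reindex_bij_betw)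
    also have "\<dots> = 2 ^ p - 1" by (simp add: sum_gp_strict)
    finally have "(\<Sum>j<p. loop_scale p j (n j)) = 2 powi e * (2 ^ p - 1)"
      by (simp add: loop_scale_n flip: sum_distrib_left)
    also have "\<dots> \<le> 2 * \<bar>z\<bar> / D * (2 ^ p - 1)" by (intro mult_right_mono z_ge) simp
    finally show ?thesis .
  qed
  ultimately show ?thesis by (rule that)
qed

text \<open>At scale \<open>w\<close> the leading term is scale-invariant, since
  \<open>w * (c * (\<bar>z\<bar> / w)) = c * \<bar>z\<bar>\<close>. The overhead
  \<open>w * A\<close> is made small by averaging over \<open>j\<close>.\<close>

lemma trajectories_of_turn_strategy:
  fixes c c' d B :: real
  assumes P: "randomized_turn_strategy P"
    and bound: "\<And>z. z \<noteq> 0 \<Longrightarrow> (\<integral>\<^sup>+ s. turn_cost d s z \<partial>P) \<le> ennreal (c * \<bar>z\<bar> + B)"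
    and c': "c < c'" and d: "0 \<le> d"
  shows "\<exists>Q. randomized_strategy Q \<and>
    (\<forall>z. z \<noteq> 0 \<longrightarrow> (\<integral>\<^sup>+ g. search_cost g z \<partial>Q) \<le> ennreal (c' * \<bar>z\<bar>))"
proof -
  interpret P: prob_space P using P by (simp add: randomized_turn_strategy_def)
  have sets_P[measurable_cong]: "sets P = sets turn_strategy_space"
    using P by (simp add: randomized_turn_strategy_def)
  have space_P: "space P = turn_strategies"
    using sets_eq_imp_space_eq[OF sets_P] by (simp add: space_turn_strategy_space)
  note measurable_turn_cost[measurable] measurable_finds[measurable]
  define C where "C = \<bar>B\<bar>"
  have C: "0 \<le> C" by (simp add: C_def)
  have bound_C: "(\<integral>\<^sup>+ s. turn_cost d s z \<partial>P) \<le> ennreal (c * \<bar>z\<bar> + C)" if "z \<noteq> 0" for z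
    using bound[OF that] by (rule order_trans) (auto simp: C_def intro!: ennreal_leI)
  have c: "0 \<le> c"
  proof (rule ccontr)
    assume "\<not> 0 \<le> c"
    \<comment> \<open>For negative \<open>c\<close> the bound at this far target is nonpositive,
      while the cost is at least \<open>z\<close>.\<close>
    define z where "z = C / \<bar>c\<bar> + 1"
    have z: "0 < z" using C \<open>\<not> 0 \<le> c\<close> by (auto simp: z_def intro!: add_nonneg_pos)
    have "c * z + C \<le> 0" using \<open>\<not> 0 \<le> c\<close> by (simp add: z_def field_simps)
    have "(\<integral>\<^sup>+ s. ennreal z \<partial>P) \<le> (\<integral>\<^sup>+ s. turn_cost d s z \<partial>P)"
      using abs_le_turn_cost[OF _ d, of _ z] z
      by (intro nn_integral_mono) (auto simp: space_P turn_strategies_def)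
    also have "\<dots> \<le> ennreal (c * z + C)" using bound_C[of z] z by simp
    finally show False using z \<open>c * z + C \<le> 0\<close> by (simp add: P.emeasure_space_1 ennreal_neg)
  qed
  define e where "e = c' - c"
  have e: "0 < e" using c' by (simp add: e_def)
  \<comment> \<open>\<open>p\<close> makes the share of the earlier copies at most half of
    \<open>e\<close>; after that, \<open>D\<close> does the same for the additive constant
    \<open>C\<close>.\<close>
  obtain p0 where "8 * c / e < real p0" using reals_Archimedean2 by blast
  define p where "p = Suc p0"
  have p: "1 \<le> p" "8 * c \<le> e * p"
    using \<open>8 * c / e < real p0\<close> e by (auto simp: p_def field_simps)
  define D where "D = 1 + 4 * C * (1 + 2 ^ p) / e"
  have D: "0 < D" using C e by (auto simp: D_def intro!: add_pos_nonneg)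
  have "4 * C * (1 + 2 ^ p) \<le> e * D" using e by (simp add: D_def field_simps)
  also have "\<dots> \<le> e * D * p" using p e D by simp
  finally have DC: "4 * C * (1 + 2 ^ p) \<le> e * D * p" .
  have p2: "(1::real) < 2 ^ p" using p by (intro one_less_power) auto

  define good where "good s \<longleftrightarrow> (\<exists>k. finds s D k) \<and> (\<exists>k. finds s (- D) k)" for s
  \<comment> \<open>If \<open>D\<close> or \<open>- D\<close> is never found, the bound
    \<open>F\<close> below is infinite, so the searcher may stay at the origin.\<close>
  define T where "T x = (if good (snd x) then spiral p D (fst x) (snd x) else (\<lambda>u\<in>{0..}. 0))" for x
  define U where "U = measure_pmf (pmf_of_set {..<p})"
  interpret U: prob_space U unfolding U_def by (rule prob_space_measure_pmf)
  interpret UP: pair_prob_space U P ..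
  have sets_U[measurable_cong]: "sets U = sets (count_space UNIV)" by (simp add: U_def)
  have "T \<in> measurable (count_space UNIV \<Otimes>\<^sub>M turn_strategy_space) trajectory_space"
    unfolding trajectory_space_def
  proof (rule measurable_restrict_space2)
    show "T \<in> space (count_space UNIV \<Otimes>\<^sub>M turn_strategy_space) \<rightarrow> trajectories"
    proof
      fix x :: "nat \<times> bool \<times> (nat \<Rightarrow> real)"
      assume "x \<in> space (count_space UNIV \<Otimes>\<^sub>M turn_strategy_space)"
      then have "snd x \<in> turn_strategies"
        by (auto simp: space_pair_measure space_turn_strategy_space)
      then have "spiral p D (fst x) (snd x) \<in> trajectories" if "good (snd x)"
        using spiral_trajectory[OF p(1) D] that unfolding good_def by blast
      moreover have "(\<lambda>u\<in>{0..}. 0) \<in> trajectories"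
        by (auto simp: trajectories_def intro!: lipschitz_onI)
      ultimately show "T x \<in> trajectories" by (simp add: T_def)
    qed
    have [measurable]: "Measurable.pred turn_strategy_space good" unfolding good_def by measurable
    show "T \<in> measurable (count_space UNIV \<Otimes>\<^sub>M turn_strategy_space) (\<Pi>\<^sub>M t\<in>{0..}. borel)"
      unfolding T_def by (intro measurable_If measurable_spiral measurable_restrict) measurable
  qed
  then have T[measurable]: "T \<in> measurable (U \<Otimes>\<^sub>M P) trajectory_space" by simp
  define Q where "Q = distr (U \<Otimes>\<^sub>M P) trajectory_space T"
  have "(\<integral>\<^sup>+ g. search_cost g z \<partial>Q) \<le> ennreal (c' * \<bar>z\<bar>)" if z: "z \<noteq> 0" for z
  proof -
    obtain n where n: "\<And>j. \<bar>z\<bar> \<le> D * loop_scale p j (n j)"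
      "(\<Sum>j<p. loop_scale p j (n j)) \<le> 2 * \<bar>z\<bar> / D * (2 ^ p - 1)"
      using sum_scales[OF p(1) D z] by blast
    define w where "w j = loop_scale p j (n j)" for j
    have w: "0 < w j" for j by (simp add: w_def loop_scale_pos)
    define F where "F j s = ennreal (w j) * (ennreal (1 / (2 ^ p - 1)) * (turn_cost d s D + turn_cost d s (- D))
      + turn_cost d s (z / w j))" for j s
    have [measurable]: "(\<lambda>s. F j s) \<in> borel_measurable P" for j
      unfolding F_def by measurable
    have F_meas: "(\<lambda>x. F (fst x) (snd x)) \<in> borel_measurable (U \<Otimes>\<^sub>M P)"
      by (rule measurable_compose_countable[where g = fst and f = "\<lambda>j x. F j (snd x)"]) measurable
    \<comment> \<open>Overhead per unit of scale: the earlier copies, with expected loop length at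
      most \<open>2 * (c * D + C)\<close>, and the additive constant.\<close>
    define A where "A = 2 * (c * D + C) / (2 ^ p - 1) + C"
    have "0 \<le> 2 * (c * D + C) / (2 ^ p - 1)" using C c D p2 by simp
    then have A: "0 \<le> A" using C by (simp add: A_def)
    have inner: "(\<integral>\<^sup>+ s. F j s \<partial>P) \<le> ennreal (c * \<bar>z\<bar> + w j * A)" for j
    proof -
      have "(\<integral>\<^sup>+ s. F j s \<partial>P) = ennreal (w j) * (ennreal (1 / (2 ^ p - 1)) *
          ((\<integral>\<^sup>+ s. turn_cost d s D \<partial>P) + (\<integral>\<^sup>+ s. turn_cost d s (- D) \<partial>P)) + (\<integral>\<^sup>+ s. turn_cost d s (z / w j) \<partial>P))"
        unfolding F_def by (simp add: nn_integral_cmult nn_integral_add)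
      also have "\<dots> \<le> ennreal (w j) * (ennreal (1 / (2 ^ p - 1)) *
          (ennreal (c * D + C) + ennreal (c * D + C)) + ennreal (c * (\<bar>z\<bar> / w j) + C))"
        using bound_C[of D] bound_C[of "- D"] bound_C[of "z / w j"] D z w[of j]
        by (intro mult_left_mono add_mono) (auto simp: abs_divide)
      also have "\<dots> = ennreal (w j * (1 / (2 ^ p - 1) * ((c * D + C) + (c * D + C)) + (c * (\<bar>z\<bar> / w j) + C)))"
      proof -
        have eq: "ennreal v * (ennreal r * (ennreal x + ennreal x) + ennreal y) = ennreal (v * (r * (x + x) + y))"
          if "0 \<le> v" "0 \<le> r" "0 \<le> x" "0 \<le> y" for v r x y
          using that by (simp only: ennreal_plus[symmetric] ennreal_mult[symmetric] add_nonneg_nonneg mult_nonneg_nonneg)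
        show ?thesis using C c D p2 w[of j] by (intro eq) auto
      qed
      also have "w j * (1 / (2 ^ p - 1) * ((c * D + C) + (c * D + C)) + (c * (\<bar>z\<bar> / w j) + C)) = c * \<bar>z\<bar> + w j * A"
        using w[of j] p2 by (simp add: A_def field_simps)
      finally show ?thesis .
    qed
    have "(\<integral>\<^sup>+ g. search_cost g z \<partial>Q) \<le> (\<integral>\<^sup>+ x. search_cost (T x) z \<partial>(U \<Otimes>\<^sub>M P))"
      unfolding Q_def by (rule nn_integral_distr_le) (rule T)
    also have "\<dots> \<le> (\<integral>\<^sup>+ x. F (fst x) (snd x) \<partial>(U \<Otimes>\<^sub>M P))"
    proof (rule nn_integral_mono)
      fix x assume "x \<in> space (U \<Otimes>\<^sub>M P)"
      then obtain j s where x: "x = (j, s)" and s: "s \<in> turn_strategies"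
        by (auto simp: space_pair_measure space_P)
      show "search_cost (T x) z \<le> F (fst x) (snd x)"
      proof (cases "good s")
        case True
        then have found: "\<exists>k. finds s D k" "\<exists>k. finds s (- D) k" by (auto simp: good_def)
        have "search_cost (T x) z \<le> ennreal (w j) * (ennreal (loop_length D s / (2 ^ p - 1)) + turn_cost d s (z / w j))"
          using search_cost_spiral[OF p(1) D s found z n(1) d] True by (simp add: T_def x w_def)
        also have "ennreal (loop_length D s / (2 ^ p - 1)) = ennreal (1 / (2 ^ p - 1)) * ennreal (loop_length D s)"
          using p2 loop_length_nonneg[OF p(1) D s found] by (subst ennreal_mult[symmetric]) auto
        also have "ennreal (w j) * (\<dots> + turn_cost d s (z / w j)) \<le> F j s"
          unfolding F_def by (intro mult_left_mono add_mono loop_length_le[OF p(1) D s found d]) auto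
        finally show ?thesis by (simp add: x)
      next
        case False
        then have "turn_cost d s D + turn_cost d s (- D) = \<top>"
          by (auto simp: good_def turn_cost_def)
        then have "F j s = \<top>"
          unfolding F_def \<open>turn_cost d s D + turn_cost d s (- D) = \<top>\<close> using p2 w[of j]
          by (simp add: ennreal_mult_top)
        then show ?thesis by (simp add: x)
      qed
    qed
    also have "\<dots> = (\<integral>\<^sup>+ j. (\<integral>\<^sup>+ s. F j s \<partial>P) \<partial>U)"
      using P.nn_integral_fst[OF F_meas] by simp
    also have "\<dots> \<le> (\<integral>\<^sup>+ j. ennreal (c * \<bar>z\<bar> + w j * A) \<partial>U)"
      by (intro nn_integral_mono inner)
    also have "\<dots> = (\<Sum>j<p. ennreal (c * \<bar>z\<bar> + w j * A)) / real p"
      unfolding U_def using p by (subst nn_integral_pmf_of_set) (auto simp: lessThan_empty_iff ennreal_of_nat_eq_real_of_nat)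
    also have "\<dots> = ennreal ((\<Sum>j<p. c * \<bar>z\<bar> + w j * A) / real p)"
      using c A w p by (subst sum_ennreal) (auto simp: divide_ennreal less_imp_le sum_nonneg)
    also have "\<dots> \<le> ennreal (c' * \<bar>z\<bar>)"
    proof (rule ennreal_leI)
      have "(\<Sum>j<p. c * \<bar>z\<bar> + w j * A) = p * (c * \<bar>z\<bar>) + (\<Sum>j<p. w j) * A"
        by (simp add: sum.distrib sum_distrib_right)
      also have "(\<Sum>j<p. w j) * A \<le> 2 * \<bar>z\<bar> / D * (2 ^ p - 1) * A"
        using n(2) A by (intro mult_right_mono) (auto simp: w_def)
      also have "\<dots> = \<bar>z\<bar> / D * (2 * (2 * (c * D + C) + C * (2 ^ p - 1)))"
        using p2 D by (simp add: A_def field_simps)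
      also have "\<dots> = \<bar>z\<bar> / D * (4 * c * D + 2 * C * (1 + 2 ^ p))" by (simp add: algebra_simps)
      also have "\<dots> \<le> \<bar>z\<bar> / D * (e * D * p)"
      proof (intro mult_left_mono)
        have "8 * c * D \<le> e * p * D" using D by (intro mult_right_mono p) auto
        then show "4 * c * D + 2 * C * (1 + 2 ^ p) \<le> e * D * p" using DC by (simp add: algebra_simps)
      qed (use D in auto)
      also have "\<dots> = p * (e * \<bar>z\<bar>)" using D by simp
      finally have "(\<Sum>j<p. c * \<bar>z\<bar> + w j * A) \<le> p * (c' * \<bar>z\<bar>)"
        by (simp add: e_def algebra_simps)
      then show "(\<Sum>j<p. c * \<bar>z\<bar> + w j * A) / real p \<le> c' * \<bar>z\<bar>"
        using p by (simp add: field_simps)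
    qed
    finally show ?thesis .
  qed
  moreover have "randomized_strategy Q"
    unfolding randomized_strategy_def Q_def by (auto intro!: UP.prob_space_distr T)
  ultimately show ?thesis by blast
qed

text \<open>An arbitrarily small loss in the ratio does not change the infimum.\<close>

lemma Inf_ereal_image_le:
  assumes "\<And>c c'. c \<in> A \<Longrightarrow> c < c' \<Longrightarrow> c' \<in> (A' :: real set)"
  shows "Inf (ereal ` A') \<le> Inf (ereal ` A)"
proof (rule Inf_greatest)
  fix x assume "x \<in> ereal ` A"
  then obtain c where c: "c \<in> A" "x = ereal c" by blast
  have "Inf (ereal ` A') \<le> ereal c + ereal e" if "0 < e" for e :: real
  proof (rule Inf_lower)
    have "c + e \<in> A'" using assms[OF c(1)] that by simp
    then show "ereal c + ereal e \<in> ereal ` A'" by (metis imageI plus_ereal.simps(1))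
  qed
  then show "Inf (ereal ` A') \<le> x" unfolding c(2) by (rule ereal_le_epsilon2)
qed

theorem theorem8:
  fixes d :: real
  assumes "d > 0"
  shows "opt_turn_ratio d = opt_ratio"
  unfolding opt_turn_ratio_def opt_ratio_def
proof (intro antisym Inf_ereal_image_le; clarify)
  fix c c' P
  assume "c < c'" "randomized_strategy P"
    "\<forall>z. z \<noteq> 0 \<longrightarrow> (\<integral>\<^sup>+ g. search_cost g z \<partial>P) \<le> ennreal (c * \<bar>z\<bar>)"
  then show "\<exists>B Q. randomized_turn_strategy Q \<and>
    (\<forall>z. z \<noteq> 0 \<longrightarrow> (\<integral>\<^sup>+ s. turn_cost d s z \<partial>Q) \<le> ennreal (c' * \<bar>z\<bar> + B))"
    using turn_strategy_of_trajectories[of P c c' d] assms by auto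
next
  fix c c' B P
  assume "c < c'" "randomized_turn_strategy P"
    "\<forall>z. z \<noteq> 0 \<longrightarrow> (\<integral>\<^sup>+ s. turn_cost d s z \<partial>P) \<le> ennreal (c * \<bar>z\<bar> + B)"
  then show "\<exists>Q. randomized_strategy Q \<and>
    (\<forall>z. z \<noteq> 0 \<longrightarrow> (\<integral>\<^sup>+ g. search_cost g z \<partial>Q) \<le> ennreal (c' * \<bar>z\<bar>))"
    using trajectories_of_turn_strategy[of P d c B c'] assms by auto
qed

end
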